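(* Given an integer $n\ge 0$, we have $$C_{\{n\}}=\sum_{C}\operatorname{wt}C,$$ where the sum is over all Catalan partial tilings $C$ associated with lattice paths from $(n-1,0)$ to $(0,2n)$ in $\delta_{2n}$. Thus $C_{\{n\}}\in\mathbb{N}[s,t]$.
   Context: Let $s,t$ be indeterminates and $\mathbb{N}=\{0,1,2,\dots\}$. The Lucas sequence is $\{0\}=0$, $\{1\}=1$, $\{n\}=s\{n-1\}+t\{n-2\}$ for $n\ge 2$; $\{n\}!=\{1\}\{2\}\cdots\{n\}$ with $\{0\}!=1$; $\left\{{n\atop k}\right\}=\frac{\{n\}!}{\{k\}!\{n-k\}!}$ for $0\le k\le n$. The Lucas analogue of the Catalan number is $C_{\{n\}}=\frac{1}{\{n+1\}}\left\{{2n\atop n}\right\}$. The staircase $\delta_N=(N-1,N-2,\dots,1)$ is drawn in the first quadrant with unit boxes, southwest corner at the origin, the $i$th row from the bottom having $N-i$ boxes (row $N$ has $0$ boxes). The unit segments from $(N-1,0)$ to $(N,0)$ and from $(0,N-1)$ to $(0,N)$ are also part of the diagram. A tiling of $\delta_N$ is a tiling of each row by monominoes (one box) and dominoes (two adjacent boxes of a row). Let $N=2n$. Given a tiling $T$ of $\delta_{2n}$, its path starts at $(n-1,0)$ and ends at $(0,2n)$: from $(x,y)$ it takes a north step $N$ to $(x,y+1)$ if this does not cross a domino of $T$ and does not leave the diagram; otherwise it takes a west step $W$ to $(x-1,y)$. A north step is $NL$ if it is immediately preceded by a west step, and $NI$ otherwise. The Catalan partial tiling $C$ associated with $T$ consists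 of the path together with the following tiles of $T$: in each row above the first (bottom) row, the tiles to the right of the north step in that row if it is $NL$, and the tiles to the left of it if it is $NI$; in the first row, no tiles if the path begins with an $N$ step, and only the domino covering the boxes in columns $n-1$ and $n$ (which blocks the path) if the path begins with a $W$ step. All other boxes are blank. Different $T$ giving the same path and the same such tiles give the same Catalan partial tiling, counted once. The weight is $\operatorname{wt}C=s^{\#\text{monominoes in }C}\,t^{\#\text{dominoes in }C}$. *)

theory Defs
  imports
    "HOL-Computational_Algebra.Computational_Algebra"
    "HOL-Library.Disjoint_Sets"
begin

text \<open>
  The ring \<open>\<int>[s,t]\<close> is represented as \<open>int poly poly\<close>, i.e. \<open>\<int>[t][s]\<close>: the outer
  variable is \<open>s\<close> and the inner one is \<open>t\<close>. Quotients are taken in its field of fractions.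
\<close>

type_synonym st_poly = "int poly poly"

definition var_s :: st_poly where "var_s = [:0, 1:]"

definition var_t :: st_poly where "var_t = [:[:0, 1:]:]"

fun lucas :: "nat \<Rightarrow> st_poly" where
  "lucas 0 = 0"
| "lucas (Suc 0) = 1"
| "lucas (Suc (Suc n)) = var_s * lucas (Suc n) + var_t * lucas n"

definition lucas_fact :: "nat \<Rightarrow> st_poly" where
  "lucas_fact n = (\<Prod>i = 1..n. lucas i)"

text \<open>Only meant for \<open>k \<le> n\<close>.\<close>

definition lucasnomial :: "nat \<Rightarrow> nat \<Rightarrow> st_poly fract" where
  "lucasnomial n k =
     to_fract (lucas_fact n) / (to_fract (lucas_fact k) * to_fract (lucas_fact (n - k)))"

definition lucas_catalan :: "nat \<Rightarrow> st_poly fract" where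
  "lucas_catalan n = 1 / to_fract (lucas (n + 1)) * lucasnomial (2 * n) n"

text \<open>The subsemiring \<open>\<nat>[s,t]\<close> of the field of fractions.\<close>

definition nat_polys :: "st_poly fract set" where
  "nat_polys = {to_fract p | p. \<forall>i j. coeff (coeff p i) j \<in> \<nat>}"


text \<open>
  The box \<open>(c, r)\<close>, in column \<open>c \<ge> 1\<close> and row \<open>r \<ge> 1\<close> (rows counted from the bottom), is the
  unit square \<open>[c - 1, c] \<times> [r - 1, r]\<close>. A tile is the set of boxes that it covers.
\<close>

type_synonym box = "nat \<times> nat"
type_synonym tile = "box set"

definition staircase :: "nat \<Rightarrow> box set" where
  "staircase N = {(c, r). 1 \<le> r \<and> r \<le> N \<and> 1 \<le> c \<and> c \<le> N - r}"

definition monomino :: "nat \<Rightarrow> nat \<Rightarrow> tile" where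
  "monomino c r = {(c, r)}"

definition domino :: "nat \<Rightarrow> nat \<Rightarrow> tile" where
  "domino c r = {(c, r), (c + 1, r)}"

definition is_monomino :: "tile \<Rightarrow> bool" where
  "is_monomino \<tau> \<longleftrightarrow> (\<exists>c r. \<tau> = monomino c r)"

definition is_domino :: "tile \<Rightarrow> bool" where
  "is_domino \<tau> \<longleftrightarrow> (\<exists>c r. \<tau> = domino c r)"

definition tilings :: "nat \<Rightarrow> tile set set" where
  "tilings N =
     {T. partition_on (staircase N) T \<and> (\<forall>\<tau>\<in>T. is_monomino \<tau> \<or> is_domino \<tau>)}"

datatype step = North | West

text \<open>
  \<open>path_from N T x y\<close> is the part of the path in the tiling \<open>T\<close> of \<open>staircase N\<close> from the
  lattice point \<open>(x, y)\<close> on. The north step from \<open>(x, y)\<close> to \<open>(x, y + 1)\<close> runs between the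
  boxes in columns \<open>x\<close> and \<open>x + 1\<close> of row \<open>y + 1\<close>, so \<open>domino x (y + 1)\<close> is the only domino
  that it could cross. It stays in the diagram iff \<open>x + y + 1 \<le> N\<close>; for \<open>x = 0\<close> and
  \<open>y = N - 1\<close> this accounts for the extra segment from \<open>(0, N - 1)\<close> to \<open>(0, N)\<close>. On the line
  \<open>x = 0\<close> there is no domino to cross, as columns are numbered from 1.
\<close>

function path_from :: "nat \<Rightarrow> tile set \<Rightarrow> nat \<Rightarrow> nat \<Rightarrow> step list" where
  "path_from N T 0 y = (if y + 1 \<le> N then North # path_from N T 0 (y + 1) else [])"
| "path_from N T (Suc x) y =
     (if domino (Suc x) (y + 1) \<notin> T \<and> Suc x + y + 1 \<le> N
      then North # path_from N T (Suc x) (y + 1)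
      else West # path_from N T x y)"
  by pat_completeness auto
termination
  by (relation "measure (\<lambda>(N, T, x, y). x + (N - y))") auto

text \<open>
  The starting point is \<open>(n - 1, 0)\<close>. For \<open>n = 0\<close> truncated subtraction makes it \<open>(0, 0)\<close>,
  which is also the end point: the diagram and the path are then empty, and there is exactly one
  Catalan partial tiling, of weight 1.
\<close>

definition catalan_path :: "nat \<Rightarrow> tile set \<Rightarrow> step list" where
  "catalan_path n T = path_from (2 * n) T (n - 1) 0"

text \<open>
  A north step of a path is described by the list \<open>u\<close> of the steps before it: it lies in row
  \<open>count_list u North + 1\<close>, on the vertical line at \<open>n - 1 - count_list u West\<close>.
\<close>

definition is_NL :: "step list \<Rightarrow> bool" where
  "is_NL u \<longleftrightarrow> u \<noteq> [] \<and> last u = West"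

definition right_tiles :: "tile set \<Rightarrow> nat \<Rightarrow> nat \<Rightarrow> tile set" where
  "right_tiles T x r = {\<tau> \<in> T. \<forall>(c, r') \<in> \<tau>. r' = r \<and> x < c}"

definition left_tiles :: "tile set \<Rightarrow> nat \<Rightarrow> nat \<Rightarrow> tile set" where
  "left_tiles T x r = {\<tau> \<in> T. \<forall>(c, r') \<in> \<tau>. r' = r \<and> c \<le> x}"

definition first_row_tiles :: "nat \<Rightarrow> step list \<Rightarrow> tile set" where
  "first_row_tiles n p = (if p \<noteq> [] \<and> hd p = West then {domino (n - 1) 1} else {})"

definition upper_row_tiles :: "nat \<Rightarrow> tile set \<Rightarrow> step list \<Rightarrow> tile set" where
  "upper_row_tiles n T p =
     \<Union> {(if is_NL u then right_tiles else left_tiles)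
            T (n - 1 - count_list u West) (count_list u North + 1)
        | u v. p = u @ North # v \<and> count_list u North + 1 > 1}"

definition catalan_partial_tiling :: "nat \<Rightarrow> tile set \<Rightarrow> step list \<times> tile set" where
  "catalan_partial_tiling n T =
     (let p = catalan_path n T in (p, first_row_tiles n p \<union> upper_row_tiles n T p))"

definition catalan_partial_tilings :: "nat \<Rightarrow> (step list \<times> tile set) set" where
  "catalan_partial_tilings n = catalan_partial_tiling n ` tilings (2 * n)"

definition wt :: "step list \<times> tile set \<Rightarrow> st_poly" where
  "wt C = var_s ^ card {\<tau> \<in> snd C. is_monomino \<tau>} * var_t ^ card {\<tau> \<in> snd C. is_domino \<tau>}"

lemma finite_staircase: "finite (staircase N)"
  by (rule finite_subset[of _ "{..N} \<times> {..N}"]) (auto simp: staircase_def)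

lemma finite_tilings: "finite (tilings N)"
  by (rule finite_subset[of _ "Pow (Pow (staircase N))"])
     (auto simp: tilings_def partition_on_def finite_staircase)

lemma finite_catalan_partial_tilings: "finite (catalan_partial_tilings n)"
  by (simp add: catalan_partial_tilings_def finite_tilings)

end

theory Submission imports Defs begin

text \<open>
  Write \<open>{n}\<close> for \<open>lucas n\<close>. A row of \<open>k\<close> boxes has tilings of total weight \<open>{k + 1}\<close>
  (\<open>sum_wt_strip\<close>). Let \<open>N = 2 n\<close>, and let \<open>F(x, y)\<close> be the total weight of the partial tilings that can
  arise from \<open>(x, y)\<close> on, for \<open>y \<ge> 1\<close>. There are two ways to pass through row \<open>y + 1\<close>, which has
  \<open>N - y - 1\<close> boxes. If the path goes north at once, the \<open>x\<close> boxes on its left may be tiled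
  arbitrarily. Otherwise a domino in the columns \<open>x\<close> and \<open>x + 1\<close> blocks it; it then makes one step
  west followed by a north step, and the boxes on its right carry this domino and an arbitrary tiling
  of the remaining \<open>N - y - x - 2\<close> boxes. Hence, for \<open>0 < x < N - y\<close>,
  
    \<open>F(x, y) = {x + 1} F(x, y + 1) + t {N - y - 1 - x} F(x - 1, y + 1)\<close>.
  
  This is the recursion of the lucasnomials \<open>{N - y choose x}\<close>, and the boundary values agree as well,
  so \<open>F(x, y)\<close> is that lucasnomial (\<open>weight_partial_tilings\<close>). The bottom row has weight \<open>1\<close> if the
  path begins with a north step and \<open>t\<close> if it begins with a west step. For \<open>n \<ge> 2\<close> the Catalan
  partial tilings therefore have total weight
  
    \<open>{2 n - 1 choose n - 1} + t {2 n - 1 choose n - 2}\<close>,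
  
  which equals \<open>{2 n}! / ({n}! {n + 1}!)\<close> because \<open>{2 n} = {n + 1} {n} + t {n} {n - 1}\<close>
  (\<open>weight_catalan_partial_tilings\<close>).
  
  A Catalan partial tiling only records part of a tiling and is counted once, so the recursion requires
  that the recorded choices in different rows be independent. This is shown by exchanging a
  single row of a tiling (\<open>exists_tiling_with_row_part\<close>), on which the path above that row does not
  depend (\<open>path_from_cong\<close>, \<open>tiles_from_cong\<close>).
\<close>

section \<open>Tilings of arbitrary regions\<close>

definition tilings_of :: "box set \<Rightarrow> tile set set" where
  "tilings_of X = {A. partition_on X A \<and> (\<forall>\<tau>\<in>A. is_monomino \<tau> \<or> is_domino \<tau>)}"

definition strip :: "nat \<Rightarrow> nat \<Rightarrow> nat \<Rightarrow> box set" where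
  "strip a b r = {a<..b} \<times> {r}"

definition tiles_in :: "tile set \<Rightarrow> box set \<Rightarrow> tile set" where
  "tiles_in T Y = {\<tau> \<in> T. \<tau> \<subseteq> Y}"

lemma tilings_eq: "tilings N = tilings_of (staircase N)"
  by (simp add: tilings_def tilings_of_def)

lemma tilings_ofD:
  assumes "A \<in> tilings_of X"
  shows "\<Union>A = X" "\<And>\<tau>. \<tau> \<in> A \<Longrightarrow> \<tau> \<noteq> {}" "\<And>\<tau>. \<tau> \<in> A \<Longrightarrow> \<tau> \<subseteq> X"
    "\<And>\<tau>. \<tau> \<in> A \<Longrightarrow> is_monomino \<tau> \<or> is_domino \<tau>"
    "\<And>\<tau> \<sigma>. \<lbrakk>\<tau> \<in> A; \<sigma> \<in> A; \<tau> \<inter> \<sigma> \<noteq> {}\<rbrakk> \<Longrightarrow> \<tau> = \<sigma>"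
  using assms unfolding tilings_of_def partition_on_def disjoint_def by blast+

lemma tilings_ofI:
  assumes "\<Union>A = X" "\<And>\<tau>. \<tau> \<in> A \<Longrightarrow> is_monomino \<tau> \<or> is_domino \<tau>"
    "\<And>\<tau> \<sigma>. \<lbrakk>\<tau> \<in> A; \<sigma> \<in> A; \<tau> \<inter> \<sigma> \<noteq> {}\<rbrakk> \<Longrightarrow> \<tau> = \<sigma>"
  shows "A \<in> tilings_of X"
proof -
  have "\<tau> \<noteq> {}" if "\<tau> \<in> A" for \<tau>
    using assms(2)[OF that] by (auto simp: is_monomino_def is_domino_def monomino_def domino_def)
  then show ?thesis
    using assms unfolding tilings_of_def partition_on_def disjoint_def by blast
qed

lemma finite_tilings_of: "finite X \<Longrightarrow> finite (tilings_of X)"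
  by (rule finite_subset[of _ "Pow (Pow X)"]) (auto simp: tilings_of_def partition_on_def)

lemma finite_tiling: "A \<in> tilings_of X \<Longrightarrow> finite X \<Longrightarrow> finite A"
  by (rule finite_subset[of _ "Pow X"]) (auto dest: tilings_ofD)

lemma tilings_of_empty: "tilings_of {} = {{}}"
  by (auto simp: tilings_of_def partition_on_def)

lemma tilings_of_Un:
  assumes A: "A \<in> tilings_of X" and B: "B \<in> tilings_of Y" and "X \<inter> Y = {}"
  shows "A \<union> B \<in> tilings_of (X \<union> Y)"
proof (rule tilings_ofI)
  show "\<Union>(A \<union> B) = X \<union> Y"
    using tilings_ofD(1)[OF A] tilings_ofD(1)[OF B] by blast
  show "is_monomino \<tau> \<or> is_domino \<tau>" if "\<tau> \<in> A \<union> B" for \<tau>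
    using that tilings_ofD(4)[OF A] tilings_ofD(4)[OF B] by blast
  fix \<tau> \<sigma> assume \<tau>: "\<tau> \<in> A \<union> B" and \<sigma>: "\<sigma> \<in> A \<union> B" and meet: "\<tau> \<inter> \<sigma> \<noteq> {}"
  have "\<alpha> \<inter> \<beta> = {}" if "\<alpha> \<in> A" "\<beta> \<in> B" for \<alpha> \<beta>
    using tilings_ofD(3)[OF A that(1)] tilings_ofD(3)[OF B that(2)] assms(3) by blast
  with \<tau> \<sigma> meet have "\<tau> \<in> A \<and> \<sigma> \<in> A \<or> \<tau> \<in> B \<and> \<sigma> \<in> B" by blast
  with meet show "\<tau> = \<sigma>"
    using tilings_ofD(5)[OF A, of \<tau> \<sigma>] tilings_ofD(5)[OF B, of \<tau> \<sigma>] by blast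
qed

lemma tiles_in_tiling:
  assumes T: "T \<in> tilings_of X" and "Y \<subseteq> X" and "\<And>\<tau>. \<tau> \<in> T \<Longrightarrow> \<tau> \<inter> Y = {} \<or> \<tau> \<subseteq> Y"
  shows "tiles_in T Y \<in> tilings_of Y"
proof (rule tilings_ofI)
  show "\<Union>(tiles_in T Y) = Y"
      proof (intro equalityI subsetI)
    fix b assume "b \<in> Y"
    with assms(2) obtain \<tau> where "\<tau> \<in> T" "b \<in> \<tau>"
      using tilings_ofD(1)[OF T] by blast
    with assms(3) \<open>b \<in> Y\<close> show "b \<in> \<Union>(tiles_in T Y)"
      unfolding tiles_in_def by blast
  qed (auto simp: tiles_in_def)
next
  fix \<tau> assume "\<tau> \<in> tiles_in T Y"
  then show "is_monomino \<tau> \<or> is_domino \<tau>"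
    using tilings_ofD(4)[OF T] by (simp add: tiles_in_def)
next
  fix \<tau> \<sigma> assume "\<tau> \<in> tiles_in T Y" "\<sigma> \<in> tiles_in T Y" "\<tau> \<inter> \<sigma> \<noteq> {}"
  then show "\<tau> = \<sigma>"
    using tilings_ofD(5)[OF T] by (simp add: tiles_in_def)
qed

text \<open>
  Removing a fixed tile is a bijection onto the tilings of the remaining region. All counting of
  row tilings below comes from this, by choosing the tile at the left end of the row.
\<close>

lemma tilings_of_containing:
  assumes "is_monomino \<tau> \<or> is_domino \<tau>" and "\<tau> \<subseteq> X"
  shows "{A \<in> tilings_of X. \<tau> \<in> A} = insert \<tau> ` tilings_of (X - \<tau>)"
proof (intro equalityI subsetI)
  fix A assume "A \<in> {A \<in> tilings_of X. \<tau> \<in> A}"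
  then have A: "A \<in> tilings_of X" and \<tau>: "\<tau> \<in> A" by auto
  have "A - {\<tau>} \<in> tilings_of (X - \<tau>)"
  proof (rule tilings_ofI)
    show "\<Union>(A - {\<tau>}) = X - \<tau>"
      using tilings_ofD(1,5)[OF A] \<tau> by blast
  qed (use tilings_ofD[OF A] in auto)
  moreover have "A = insert \<tau> (A - {\<tau>})" using \<tau> by blast
  ultimately show "A \<in> insert \<tau> ` tilings_of (X - \<tau>)" by blast
next
  fix A assume "A \<in> insert \<tau> ` tilings_of (X - \<tau>)"
  then obtain B where B: "B \<in> tilings_of (X - \<tau>)" and A: "A = insert \<tau> B" by blast
  have "{\<tau>} \<in> tilings_of \<tau>"
    by (rule tilings_ofI) (use assms in auto)
  from tilings_of_Un[OF this B] have "insert \<tau> B \<in> tilings_of (\<tau> \<union> (X - \<tau>))" by simp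
  moreover have "\<tau> \<union> (X - \<tau>) = X" using assms(2) by blast
  ultimately show "A \<in> {A \<in> tilings_of X. \<tau> \<in> A}" using A by simp
qed

lemma monominoes_tiling: "(\<lambda>b. {b}) ` X \<in> tilings_of X"
  by (rule tilings_ofI) (auto simp: is_monomino_def monomino_def)

lemma is_monomino_monomino [simp]: "is_monomino (monomino c r)"
  and is_domino_domino [simp]: "is_domino (domino c r)"
  by (auto simp: is_monomino_def is_domino_def)

lemma card_monomino: "is_monomino \<tau> \<Longrightarrow> card \<tau> = 1"
  and card_domino: "is_domino \<tau> \<Longrightarrow> card \<tau> = 2"
  by (auto simp: is_monomino_def is_domino_def monomino_def domino_def)

lemma not_is_domino_monomino [simp]: "\<not> is_domino (monomino c r)"
  and not_is_monomino_domino [simp]: "\<not> is_monomino (domino c r)"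
  using card_monomino[of "monomino c r"] card_domino[of "monomino c r"]
    card_monomino[of "domino c r"] card_domino[of "domino c r"] by auto

section \<open>Weights\<close>

lemma wt_Un:
  assumes "finite A" "finite B" "A \<inter> B = {}"
  shows "wt (p, A \<union> B) = wt (q, A) * wt (q', B)"
proof -
  have eq: "{\<tau> \<in> A \<union> B. P \<tau>} = {\<tau> \<in> A. P \<tau>} \<union> {\<tau> \<in> B. P \<tau>}" for P by blast
  have "card {\<tau> \<in> A \<union> B. P \<tau>} = card {\<tau> \<in> A. P \<tau>} + card {\<tau> \<in> B. P \<tau>}" for P
    unfolding eq by (rule card_Un_disjoint) (use assms in auto)
  then show ?thesis
    by (simp add: wt_def power_add mult.assoc mult.left_commute)
qed

lemma wt_empty [simp]: "wt (p, {}) = 1"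
  by (simp add: wt_def)

lemma wt_monomino: "wt (p, {monomino c r}) = var_s"
proof -
  have m: "{\<tau> \<in> {monomino c r}. is_monomino \<tau>} = {monomino c r}"
    and d: "{\<tau> \<in> {monomino c r}. is_domino \<tau>} = {}" by auto
  show ?thesis unfolding wt_def snd_conv m d by simp
qed

lemma wt_domino: "wt (p, {domino c r}) = var_t"
proof -
  have m: "{\<tau> \<in> {domino c r}. is_monomino \<tau>} = {}"
    and d: "{\<tau> \<in> {domino c r}. is_domino \<tau>} = {domino c r}" by auto
  show ?thesis unfolding wt_def snd_conv m d by simp
qed

lemma sum_wt_tilings_containing:
  assumes "is_monomino \<tau> \<or> is_domino \<tau>" "\<tau> \<subseteq> X" "finite X"
  shows "(\<Sum>A | A \<in> tilings_of X \<and> \<tau> \<in> A. wt (p, A)) =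
         wt (p, {\<tau>}) * (\<Sum>A\<in>tilings_of (X - \<tau>). wt (p, A))"
proof -
  have "\<tau> \<noteq> {}"
    using assms(1) by (auto simp: is_monomino_def is_domino_def monomino_def domino_def)
  then have notin: "\<tau> \<notin> A" if "A \<in> tilings_of (X - \<tau>)" for A
    using tilings_ofD(3)[OF that, of \<tau>] by blast
  have inj: "inj_on (insert \<tau>) (tilings_of (X - \<tau>))"
    by (rule inj_onI) (metis Diff_insert_absorb notin)
  have "wt (p, insert \<tau> A) = wt (p, {\<tau>}) * wt (p, A)" if "A \<in> tilings_of (X - \<tau>)" for A
    using wt_Un[of "{\<tau>}" A p p p] notin[OF that] finite_tiling[OF that] assms(3) by simp
  then show ?thesis
    unfolding tilings_of_containing[OF assms(1,2)]
    by (simp add: sum.reindex[OF inj] sum_distrib_left)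
qed

section \<open>Rows are counted by Lucas polynomials\<close>

lemma finite_strip [simp]: "finite (strip a b r)"
  by (simp add: strip_def)

text \<open>
  Rows that begin with a domino are singled out because they also describe the tiles to the right
  of an \<open>NL\<close> step: the domino that blocked the path is the first of them.
\<close>

lemma sum_wt_strip_domino_first:
  assumes "a < b"
  shows "(\<Sum>A | A \<in> tilings_of (strip a b r) \<and> domino (Suc a) r \<in> A. wt (p, A)) =
    (if Suc a = b then 0 else var_t * (\<Sum>A\<in>tilings_of (strip (a + 2) b r). wt (p, A)))"
proof (cases "Suc a = b")
  case True
  then have "{A. A \<in> tilings_of (strip a b r) \<and> domino (Suc a) r \<in> A} = {}"
    using tilings_ofD(3)[of _ "strip a b r" "domino (Suc a) r"]
    by (auto simp: strip_def domino_def)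
  then show ?thesis using True by (metis (no_types, lifting) sum.empty)
next
  case False
  with assms have "domino (Suc a) r \<subseteq> strip a b r"
    and "strip a b r - domino (Suc a) r = strip (a + 2) b r"
    by (auto simp: strip_def domino_def)
  then show ?thesis
    using False by (simp add: sum_wt_tilings_containing wt_domino)
qed

text \<open>
  The leftmost box is covered by a monomino or by the first box of a domino; this is the Lucas
  recursion.
\<close>

lemma sum_wt_strip_Suc:
  assumes "a < b"
  shows "(\<Sum>A\<in>tilings_of (strip a b r). wt (p, A)) =
    var_s * (\<Sum>A\<in>tilings_of (strip (Suc a) b r). wt (p, A)) +
    (if Suc a = b then 0 else var_t * (\<Sum>A\<in>tilings_of (strip (a + 2) b r). wt (p, A)))"
proof -
  let ?M = "{A. A \<in> tilings_of (strip a b r) \<and> monomino (Suc a) r \<in> A}"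
  let ?D = "{A. A \<in> tilings_of (strip a b r) \<and> domino (Suc a) r \<in> A}"
  have M: "monomino (Suc a) r \<subseteq> strip a b r"
    "strip a b r - monomino (Suc a) r = strip (Suc a) b r"
    using assms by (auto simp: strip_def monomino_def)
  have "monomino (Suc a) r \<in> A \<or> domino (Suc a) r \<in> A" if A: "A \<in> tilings_of (strip a b r)" for A
  proof -
    have "(Suc a, r) \<in> \<Union>A"
      unfolding tilings_ofD(1)[OF A] using assms by (simp add: strip_def)
    then obtain \<tau> where \<tau>: "\<tau> \<in> A" "(Suc a, r) \<in> \<tau>" by blast
    have sub: "\<tau> \<subseteq> strip a b r" using tilings_ofD(3)[OF A \<tau>(1)] .
    have "\<tau> = monomino (Suc a) r \<or> \<tau> = domino (Suc a) r"
      using tilings_ofD(4)[OF A \<tau>(1)] \<tau>(2) sub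
      by (auto simp: is_monomino_def is_domino_def monomino_def domino_def strip_def)
    then show ?thesis using \<tau>(1) by blast
  qed
  then have Un: "tilings_of (strip a b r) = ?M \<union> ?D" by blast
  have "\<not> (monomino (Suc a) r \<in> A \<and> domino (Suc a) r \<in> A)" if A: "A \<in> tilings_of (strip a b r)" for A
    using tilings_ofD(5)[OF A, of "monomino (Suc a) r" "domino (Suc a) r"]
    by (auto simp: monomino_def domino_def)
  then have "?M \<inter> ?D = {}" by blast
  moreover have "finite ?M" "finite ?D"
    by (rule finite_subset[OF _ finite_tilings_of[OF finite_strip]]; blast)+
  ultimately have "(\<Sum>A\<in>tilings_of (strip a b r). wt (p, A)) = (\<Sum>A\<in>?M. wt (p, A)) + (\<Sum>A\<in>?D. wt (p, A))"
    by (subst Un, subst sum.union_disjoint) auto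
  then show ?thesis
    using assms M by (simp add: sum_wt_strip_domino_first sum_wt_tilings_containing wt_monomino)
qed

lemma sum_wt_strip: "(\<Sum>A\<in>tilings_of (strip a b r). wt (p, A)) = lucas (Suc (b - a))"
proof (induction "b - a" arbitrary: a rule: less_induct)
  case less
  show ?case
  proof (cases "a < b")
    case False
    then have "strip a b r = {}" by (simp add: strip_def)
    then show ?thesis using False by (simp add: tilings_of_empty)
  next
    case True
    note IH1 = less.hyps[of "Suc a"] and IH2 = less.hyps[of "a + 2"]
    show ?thesis
    proof (cases "Suc a = b")
      case True
      then have "b - a = Suc 0" by simp
      with True \<open>a < b\<close> IH1 show ?thesis by (simp add: sum_wt_strip_Suc)
    next
      case False
      with \<open>a < b\<close> obtain k where "b - a = Suc (Suc k)" "b - Suc a = Suc k" "b - (a + 2) = k"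
        by (intro that[of "b - (a + 2)"]) auto
      with \<open>a < b\<close> False IH1 IH2 show ?thesis by (simp add: sum_wt_strip_Suc)
    qed
  qed
qed

text \<open>
  If there is only one box, no tiling begins with a domino, and the formula gives \<open>lucas 0 = 0\<close>.
\<close>

lemma sum_wt_strip_domino_first_lucas:
  assumes "a < b"
  shows "(\<Sum>A | A \<in> tilings_of (strip a b r) \<and> domino (Suc a) r \<in> A. wt (p, A)) =
    var_t * lucas (b - Suc a)"
proof (cases "Suc a = b")
  case False
  with assms have "Suc (b - (a + 2)) = b - Suc a" by simp
  with assms False show ?thesis by (simp only: sum_wt_strip_domino_first sum_wt_strip if_False)
next
  case True
  then show ?thesis
    unfolding sum_wt_strip_domino_first[OF assms] by simp
qed

section \<open>Replacing one row of a tiling\<close>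

lemma row_of_tile:
  assumes "is_monomino \<tau> \<or> is_domino \<tau>"
  obtains r where "\<tau> \<subseteq> UNIV \<times> {r}"
  using assms by (auto simp: is_monomino_def is_domino_def monomino_def domino_def)

text \<open>
  The choices made in different rows are independent: part of a row of a tiling can be replaced by
  any tiling \<open>A\<close> of that part, leaving the rows above untouched. The other boxes of the row are
  filled with monominoes, so that no tile crosses the boundary of the replaced part.
\<close>

lemma exists_tiling_with_row_part:
  assumes T: "T \<in> tilings N" and A: "A \<in> tilings_of X"
    and X: "X \<subseteq> strip 0 (N - r) r" and r: "1 \<le> r" "r \<le> N"
  shows "\<exists>T'\<in>tilings N. tiles_in T' X = A \<and> (\<forall>\<tau>\<in>T'. \<tau> \<inter> X = {} \<or> \<tau> \<subseteq> X) \<and>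
           (\<forall>\<tau>. \<tau> \<subseteq> UNIV \<times> {r<..} \<longrightarrow> (\<tau> \<in> T' \<longleftrightarrow> \<tau> \<in> T))"
proof -
  let ?row = "strip 0 (N - r) r"
  let ?rest = "tiles_in T (staircase N - ?row)"
  let ?M = "(\<lambda>b. {b}) ` (?row - X)"
  define T' where "T' = ?rest \<union> (A \<union> ?M)"
  have row: "?row \<subseteq> staircase N"
    using r by (auto simp: staircase_def strip_def)
  note T0 = T[unfolded tilings_eq]
  have "?rest \<in> tilings_of (staircase N - ?row)"
  proof (rule tiles_in_tiling[OF T0])
    show "\<tau> \<inter> (staircase N - ?row) = {} \<or> \<tau> \<subseteq> staircase N - ?row" if \<tau>: "\<tau> \<in> T" for \<tau>
    proof -
      obtain r' where "\<tau> \<subseteq> UNIV \<times> {r'}"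
        using tilings_ofD(4)[OF T0 \<tau>] row_of_tile by blast
      then show ?thesis
        using tilings_ofD(3)[OF T0 \<tau>] by (cases "r' = r") (auto simp: staircase_def strip_def)
    qed
  qed blast
  moreover have "A \<union> ?M \<in> tilings_of (X \<union> (?row - X))"
    by (rule tilings_of_Un[OF A monominoes_tiling]) blast
  moreover have "X \<union> (?row - X) = ?row" using X by blast
  ultimately have "T' \<in> tilings_of (staircase N - ?row \<union> ?row)"
    unfolding T'_def by (intro tilings_of_Un) auto
  moreover have "staircase N - ?row \<union> ?row = staircase N" using row by blast
  ultimately have T': "T' \<in> tilings N" by (simp add: tilings_eq)
  moreover have "tiles_in T' X = A"
  proof (intro equalityI subsetI)
    fix \<tau> assume "\<tau> \<in> tiles_in T' X"
    then have "\<tau> \<in> T'" and \<tau>: "\<tau> \<subseteq> X" by (simp_all add: tiles_in_def)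
    have "\<tau> \<noteq> {}" using tilings_ofD(2)[OF T'[unfolded tilings_eq] \<open>\<tau> \<in> T'\<close>] .
    with \<tau> X have "\<tau> \<notin> ?rest" by (auto simp: tiles_in_def)
    moreover have "\<tau> \<notin> ?M" using \<tau> by auto
    ultimately show "\<tau> \<in> A" using \<open>\<tau> \<in> T'\<close> by (simp add: T'_def)
  next
    fix \<tau> assume "\<tau> \<in> A"
    then show "\<tau> \<in> tiles_in T' X"
      using tilings_ofD(3)[OF A] by (simp add: T'_def tiles_in_def)
  qed
  moreover have "\<tau> \<inter> X = {} \<or> \<tau> \<subseteq> X" if "\<tau> \<in> T'" for \<tau>
    using that X tilings_ofD(3)[OF A] unfolding T'_def tiles_in_def by blast
  moreover have "\<tau> \<in> T' \<longleftrightarrow> \<tau> \<in> T" if \<tau>: "\<tau> \<subseteq> UNIV \<times> {r<..}" for \<tau>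
  proof
    assume *: "\<tau> \<in> T'"
    then have "\<tau> \<noteq> {}" using tilings_ofD(2) T' tilings_eq by blast
    with \<tau> have "\<not> \<tau> \<subseteq> ?row" by (auto simp: strip_def)
    then show "\<tau> \<in> T"
      using * X tilings_ofD(3)[OF A] unfolding T'_def tiles_in_def by blast
  next
    assume "\<tau> \<in> T"
    moreover from this \<tau> have "\<tau> \<subseteq> staircase N - ?row"
      using tilings_ofD(3)[OF T0] by (auto simp: strip_def)
    ultimately show "\<tau> \<in> T'" by (simp add: T'_def tiles_in_def)
  qed
  ultimately show ?thesis by blast
qed

text \<open>
  Such a domino would straddle the right end of the strip. For \<open>a = 0\<close> this says that nothing blocks
  a path at \<open>b\<close> when the boxes on its left are tiled separately.
\<close>

lemma domino_notin_if_uncrossed: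
  assumes "\<forall>\<tau>\<in>T. \<tau> \<inter> strip a b r = {} \<or> \<tau> \<subseteq> strip a b r" and "a < b"
  shows "domino b r \<notin> T"
  using assms by (auto simp: domino_def strip_def)

section \<open>The tiles along the path\<close>

text \<open>
  The tiles that the path collects after reaching \<open>(x, y)\<close>, one row per unfolding. A west step and
  the north step after it are taken together (a path never makes two west steps in a row, see
  \<open>path_from_West\<close> below), so the last branch already belongs to an \<open>NL\<close> step at \<open>x - 1\<close>. On the line
  \<open>x = 0\<close> only \<open>NI\<close> steps remain to be made, and there are no tiles to their left.
\<close>

function tiles_from :: "nat \<Rightarrow> tile set \<Rightarrow> nat \<Rightarrow> nat \<Rightarrow> tile set" where
  "tiles_from N T x y =
     (if N \<le> y then {}
      else if x = 0 then tiles_from N T 0 (y + 1)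
      else if domino x (y + 1) \<notin> T \<and> x + y + 1 \<le> N
      then left_tiles T x (y + 1) \<union> tiles_from N T x (y + 1)
      else right_tiles T (x - 1) (y + 1) \<union> tiles_from N T (x - 1) (y + 1))"
  by pat_completeness auto
termination
  by (relation "measure (\<lambda>(N, T, x, y). N - y)") auto

declare tiles_from.simps [simp del] path_from.simps [simp del]

lemma tiling_tile_bounds:
  assumes "T \<in> tilings N" "\<tau> \<in> T" "(c, r) \<in> \<tau>"
  shows "1 \<le> r" "r \<le> N" "1 \<le> c" "c + r \<le> N"
  using tilings_ofD(3)[OF assms(1)[unfolded tilings_eq] assms(2)] assms(3)
  by (auto simp: staircase_def)

lemma left_tiles_eq:
  assumes T: "T \<in> tilings N"
  shows "left_tiles T x r = tiles_in T (strip 0 x r)"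
  unfolding left_tiles_def tiles_in_def
proof (rule Collect_cong, rule conj_cong)
  fix \<tau> assume "\<tau> \<in> T"
  then have "1 \<le> fst b" if "b \<in> \<tau>" for b
    using tiling_tile_bounds(3)[OF T, of \<tau> "fst b" "snd b"] that by simp
  then show "(\<forall>(c, r')\<in>\<tau>. r' = r \<and> c \<le> x) \<longleftrightarrow> \<tau> \<subseteq> strip 0 x r"
    by (auto simp: strip_def subset_iff Ball_def Suc_le_eq)
qed simp

lemma right_tiles_eq:
  assumes T: "T \<in> tilings N"
  shows "right_tiles T x r = tiles_in T (strip x (N - r) r)"
  unfolding right_tiles_def tiles_in_def
proof (rule Collect_cong, rule conj_cong)
  fix \<tau> assume "\<tau> \<in> T"
  then have "fst b \<le> N - snd b" if "b \<in> \<tau>" for b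
    using tiling_tile_bounds(4)[OF T, of \<tau> "fst b" "snd b"] that by simp
  then show "(\<forall>(c, r')\<in>\<tau>. r' = r \<and> x < c) \<longleftrightarrow> \<tau> \<subseteq> strip x (N - r) r"
    by (auto simp: strip_def subset_iff Ball_def)
qed simp

text \<open>
  After a west step the path can always go north. If the step was forced by the domino in the columns
  \<open>x + 1\<close> and \<open>x + 2\<close>, then that domino prevents a second one from covering the columns \<open>x\<close> and
  \<open>x + 1\<close>; if it was forced by the boundary, then column \<open>x + 1\<close> has no box in that row.
\<close>

lemma path_from_West:
  assumes T: "T \<in> tilings N" and xy: "Suc x + y \<le> N"
    and west: "domino (Suc x) (y + 1) \<in> T \<or> Suc x + y = N"
  shows "path_from N T (Suc x) y = West # North # path_from N T x (y + 1)"
proof -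
  have "\<not> (domino (Suc x) (y + 1) \<notin> T \<and> Suc x + y + 1 \<le> N)" using west by auto
  then have "path_from N T (Suc x) y = West # path_from N T x y"
    by (simp only: path_from.simps(2)[of N T x y] if_False)
  moreover have "path_from N T x y = North # path_from N T x (y + 1)"
  proof (cases x)
    case 0
    with xy show ?thesis by (simp add: path_from.simps(1)[of N T y])
  next
    case (Suc x')
    have "domino x (y + 1) \<notin> T"
    proof
      assume x: "domino x (y + 1) \<in> T"
      have "(Suc x, y + 1) \<in> domino x (y + 1)" by (simp add: domino_def)
      from tiling_tile_bounds(4)[OF T x this] have "Suc x + y \<noteq> N" by simp
      with west have "domino (Suc x) (y + 1) \<in> T" by simp
      from tilings_ofD(5)[OF T[unfolded tilings_eq] x this]
      have "domino x (y + 1) = domino (Suc x) (y + 1)" by (auto simp: domino_def)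
      then show False by (auto simp: domino_def doubleton_eq_iff)
    qed
    with Suc xy show ?thesis by (simp add: path_from.simps(2)[of N T x'])
  qed
  ultimately show ?thesis by simp
qed

lemma path_from_North:
  assumes "domino (Suc x) (y + 1) \<notin> T" "Suc x + y < N"
  shows "path_from N T (Suc x) y = North # path_from N T (Suc x) (y + 1)"
  using assms by (subst path_from.simps(2)) simp

lemma path_from_0:
  "path_from N T 0 y = (if y < N then North # path_from N T 0 (y + 1) else [])"
  by (subst path_from.simps(1)) simp

text \<open>
  From height \<open>y\<close> on, the path and its tiles depend only on the rows above \<open>y\<close>.
\<close>

lemma path_from_cong:
  assumes "\<And>\<tau>. \<tau> \<subseteq> UNIV \<times> {y<..} \<Longrightarrow> \<tau> \<in> T \<longleftrightarrow> \<tau> \<in> T'"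
  shows "path_from N T x y = path_from N T' x y"
  using assms
proof (induction N T x y rule: path_from.induct)
  case (1 N T y)
  then have "path_from N T 0 (y + 1) = path_from N T' 0 (y + 1)" if "y < N"
    using that by (intro 1) auto
  then show ?case by (simp add: path_from_0[of N _ y])
next
  case (2 N T x y)
  have d: "domino (Suc x) (y + 1) \<in> T \<longleftrightarrow> domino (Suc x) (y + 1) \<in> T'"
    by (rule 2) (auto simp: domino_def)
  show ?case
  proof (cases "domino (Suc x) (y + 1) \<notin> T \<and> Suc x + y + 1 \<le> N")
    case True
    have "path_from N T (Suc x) (y + 1) = path_from N T' (Suc x) (y + 1)"
      by (rule 2(1)[OF True], rule 2(3)) auto
    moreover have "domino (Suc x) (y + 1) \<notin> T' \<and> Suc x + y + 1 \<le> N"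
      using True d by simp
    ultimately show ?thesis
      by (simp only: path_from.simps(2)[of N _ x y] True if_True not_False_eq_True simp_thms)
  next
    case False
    have "path_from N T x y = path_from N T' x y"
      by (rule 2(2)[OF False], rule 2(3))
    moreover have "\<not> (domino (Suc x) (y + 1) \<notin> T' \<and> Suc x + y + 1 \<le> N)"
      using False d by simp
    ultimately show ?thesis
      by (simp only: path_from.simps(2)[of N _ x y] False if_False)
  qed
qed

lemma tiles_from_cong:
  assumes "\<And>\<tau>. \<tau> \<subseteq> UNIV \<times> {y<..} \<Longrightarrow> \<tau> \<in> T \<longleftrightarrow> \<tau> \<in> T'"
  shows "tiles_from N T x y = tiles_from N T' x y"
  using assms
proof (induction "N - y" arbitrary: x y)
  case 0
  then show ?case by (simp add: tiles_from.simps[of N _ _ y])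
next
  case (Suc k)
  have IH: "tiles_from N T x' (y + 1) = tiles_from N T' x' (y + 1)" for x'
    using Suc(2) by (intro Suc(1)) (auto intro!: Suc(3))
  have d: "domino x (y + 1) \<in> T \<longleftrightarrow> domino x (y + 1) \<in> T'"
    by (rule Suc(3)) (auto simp: domino_def)
  have row: "\<tau> \<in> T \<longleftrightarrow> \<tau> \<in> T'" if "\<forall>(c, r)\<in>\<tau>. r = y + 1 \<and> P c" for \<tau> P
    using that by (intro Suc(3)) auto
  have l: "left_tiles T x' (y + 1) = left_tiles T' x' (y + 1)" for x'
    unfolding left_tiles_def by (rule Collect_cong) (use row[of _ "\<lambda>c. c \<le> x'"] in blast)
  have r: "right_tiles T x' (y + 1) = right_tiles T' x' (y + 1)" for x'
    unfolding right_tiles_def by (rule Collect_cong) (use row[of _ "\<lambda>c. x' < c"] in blast)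
  show ?case
    unfolding tiles_from.simps[of N _ x y] IH d l r ..
qed

lemma tiles_from_0: "tiles_from N T 0 y = {}"
proof (induction "N - y" arbitrary: y)
  case 0
  then show ?case by (simp add: tiles_from.simps[of N _ _ y])
next
  case (Suc k)
  from Suc(2) have "k = N - (y + 1)" by simp
  from Suc(1)[OF this] show ?case by (simp add: tiles_from.simps[of N _ _ y])
qed

lemma tiles_from_North:
  assumes "domino (Suc x) (y + 1) \<notin> T" "Suc x + y < N"
  shows "tiles_from N T (Suc x) y = left_tiles T (Suc x) (y + 1) \<union> tiles_from N T (Suc x) (y + 1)"
  using assms by (subst tiles_from.simps) simp

lemma tiles_from_West:
  assumes "Suc x + y \<le> N" "domino (Suc x) (y + 1) \<in> T \<or> Suc x + y = N"
  shows "tiles_from N T (Suc x) y = right_tiles T x (y + 1) \<union> tiles_from N T x (y + 1)"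
  using assms by (subst tiles_from.simps) auto

lemma tiles_from_rows:
  assumes T: "T \<in> tilings N" and "\<tau> \<in> tiles_from N T x y"
  shows "\<tau> \<in> T \<and> \<tau> \<subseteq> UNIV \<times> {y<..}"
  using assms(2)
proof (induction "N - y" arbitrary: x y)
  case 0
  then show ?case by (simp add: tiles_from.simps[of N _ _ y])
next
  case (Suc k)
  from Suc(2) have k: "k = N - (y + 1)" by simp
  have IH: "\<tau> \<in> T \<and> \<tau> \<subseteq> UNIV \<times> {y<..}" if "\<tau> \<in> tiles_from N T x' (y + 1)" for x'
    using Suc(1)[OF k that] by auto
  have row: "\<tau> \<in> T \<and> \<tau> \<subseteq> UNIV \<times> {y<..}"
    if "\<tau> \<in> left_tiles T x' (y + 1) \<union> right_tiles T x'' (y + 1)" for x' x''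
    using that by (auto simp: left_tiles_def right_tiles_def)
  show ?case
    using Suc(3) IH row by (subst (asm) tiles_from.simps) (auto split: if_splits)
qed

text \<open>
  The contribution of the north step that follows the initial part \<open>u\<close> of a path. The bottom row is
  excluded here because its tiles are given by \<open>first_row_tiles\<close>.
\<close>

definition north_step_tiles :: "nat \<Rightarrow> tile set \<Rightarrow> step list \<Rightarrow> tile set" where
  "north_step_tiles n T u =
     (if count_list u North + 1 > 1
      then (if is_NL u then right_tiles else left_tiles) T
             (n - 1 - count_list u West) (count_list u North + 1)
      else {})"

text \<open>
  \<open>upper_row_tiles\<close> ranges over all factorisations of the path at a north step. Reading the path step
  by step, with the part already read in \<open>u\<close>, turns this into a recursion that can be compared with
  the one for \<open>tiles_from\<close>.
\<close>

fun upper_tiles_along :: "nat \<Rightarrow> tile set \<Rightarrow> step list \<Rightarrow> step list \<Rightarrow> tile set" where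
  "upper_tiles_along n T u [] = {}"
| "upper_tiles_along n T u (West # q) = upper_tiles_along n T (u @ [West]) q"
| "upper_tiles_along n T u (North # q) =
     north_step_tiles n T u \<union> upper_tiles_along n T (u @ [North]) q"

lemma upper_tiles_along_eq:
  "upper_tiles_along n T u q = (\<Union>w \<in> {w. \<exists>v. q = w @ North # v}. north_step_tiles n T (u @ w))"
proof (induction n T u q rule: upper_tiles_along.induct)
  case (1 n T u)
  then show ?case by simp
next
  case (2 n T u q)
  have "{w. \<exists>v. West # q = w @ North # v} = (#) West ` {w. \<exists>v. q = w @ North # v}"
    by (auto simp: Cons_eq_append_conv)
  with 2 show ?case by simp
next
  case (3 n T u q)
  have "{w. \<exists>v. North # q = w @ North # v} = insert [] ((#) North ` {w. \<exists>v. q = w @ North # v})"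
    by (auto simp: Cons_eq_append_conv)
  with 3 show ?case by simp
qed

lemma upper_row_tiles_eq: "upper_row_tiles n T p = upper_tiles_along n T [] p"
proof -
  let ?F = "\<lambda>u. (if is_NL u then right_tiles else left_tiles)
                T (n - 1 - count_list u West) (count_list u North + 1)"
  have "upper_row_tiles n T p =
      \<Union> (?F ` {u. (\<exists>v. p = u @ North # v) \<and> count_list u North + 1 > 1})"
    unfolding upper_row_tiles_def by (rule arg_cong[of _ _ Union]) blast
  also have "\<dots> = (\<Union>u \<in> {u. \<exists>v. p = u @ North # v}. north_step_tiles n T u)"
    unfolding north_step_tiles_def by (auto split: if_splits)
  finally show ?thesis by (simp add: upper_tiles_along_eq)
qed

lemma left_tiles_0:
  assumes "T \<in> tilings N" shows "left_tiles T 0 r = {}"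
  using tilings_ofD(2) assms
  unfolding left_tiles_eq[OF assms] tiles_in_def strip_def tilings_eq by auto

text \<open>
  The step counts in \<open>u\<close> place its end at \<open>(x, y)\<close>. That \<open>u\<close> does not end in a west step is
  maintained from row to row, since every unfolding of \<open>tiles_from\<close> ends with a north step.
\<close>

lemma upper_tiles_along_path:
  assumes T: "T \<in> tilings N" and "x + y \<le> N" "1 \<le> y"
    and "count_list u West + x = n - 1" "count_list u North = y" "\<not> is_NL u"
  shows "upper_tiles_along n T u (path_from N T x y) = tiles_from N T x y"
  using assms(2-)
proof (induction "N - y" arbitrary: x y u)
  case 0
  then have "x = 0" "y = N" by auto
  then show ?case by (simp add: path_from_0 tiles_from_0)
next
  case (Suc k)
  then have k: "k = N - (y + 1)" by simp
  note IH = Suc(1)[OF k]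
  have x: "n - 1 - count_list u West = x" using Suc.prems by simp
  show ?case
  proof (cases x)
    case 0
    have "upper_tiles_along n T (u @ [North]) (path_from N T 0 (y + 1)) = tiles_from N T 0 (y + 1)"
      using Suc.prems Suc(2) 0 by (intro IH) (auto simp: is_NL_def)
    then show ?thesis
      using Suc.prems x 0 by (simp add: path_from_0[of N T y] tiles_from_0 left_tiles_0[OF T] north_step_tiles_def)
  next
    case (Suc x')
    show ?thesis
    proof (cases "domino (Suc x') (y + 1) \<in> T \<or> Suc x' + y = N")
      case True
      have xy: "Suc x' + y \<le> N" using Suc Suc.prems by simp
      have "upper_tiles_along n T (u @ [West, North]) (path_from N T x' (y + 1)) =
          tiles_from N T x' (y + 1)"
        using Suc.prems xy Suc by (intro IH) (auto simp: is_NL_def)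
      moreover have "n - 1 - count_list (u @ [West]) West = x'" "is_NL (u @ [West])"
        using Suc.prems Suc by (auto simp: is_NL_def)
      ultimately show ?thesis
        unfolding Suc path_from_West[OF T xy True] tiles_from_West[OF xy True]
        using Suc.prems by (simp add: north_step_tiles_def)
    next
      case False
      then have c: "domino (Suc x') (y + 1) \<notin> T" "Suc x' + y < N" using Suc Suc.prems by auto
      have "upper_tiles_along n T (u @ [North]) (path_from N T x (y + 1)) = tiles_from N T x (y + 1)"
        using Suc.prems c Suc by (intro IH) (auto simp: is_NL_def)
      then show ?thesis
        unfolding Suc path_from_North[OF c] tiles_from_North[OF c]
        using Suc.prems x Suc by (simp add: north_step_tiles_def)
    qed
  qed
qed

section \<open>The recursion for partial tilings\<close>

definition partial_tilings :: "nat \<Rightarrow> nat \<Rightarrow> nat \<Rightarrow> (step list \<times> tile set) set" where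
  "partial_tilings N x y = (\<lambda>T. (path_from N T x y, tiles_from N T x y)) ` tilings N"

text \<open>
  Adding one row in all possible ways: first the steps \<open>us\<close> through the row with a tile set from \<open>\<A>\<close>,
  then a partial tiling above it from \<open>S\<close>.
\<close>

definition prepend :: "step list \<Rightarrow> tile set set \<Rightarrow> (step list \<times> tile set) set \<Rightarrow> (step list \<times> tile set) set" where
  "prepend us \<A> S = (\<lambda>(A, p, B). (us @ p, A \<union> B)) ` (\<A> \<times> S)"

lemma prependI: "A \<in> \<A> \<Longrightarrow> (p, B) \<in> S \<Longrightarrow> (us @ p, A \<union> B) \<in> prepend us \<A> S"
  unfolding prepend_def by (rule image_eqI[of _ _ "(A, p, B)"]) auto

lemma prependE:
  assumes "C \<in> prepend us \<A> S"
  obtains A p B where "A \<in> \<A>" "(p, B) \<in> S" "C = (us @ p, A \<union> B)"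
  using assms unfolding prepend_def by auto

text \<open>
  These two consequences of \<open>exists_tiling_with_row_part\<close> supply the surjectivity in
  \<open>partial_tilings_step\<close>: each way to cross a row combines with every continuation above it.
\<close>

lemma exists_tiling_with_left_part:
  assumes T: "T \<in> tilings N" and A: "A \<in> tilings_of (strip 0 (Suc x) (y + 1))"
    and xy: "Suc x + y < N"
  shows "\<exists>T'\<in>tilings N. left_tiles T' (Suc x) (y + 1) = A \<and> domino (Suc x) (y + 1) \<notin> T' \<and>
    (\<forall>x'. path_from N T' x' (y + 1) = path_from N T x' (y + 1) \<and>
          tiles_from N T' x' (y + 1) = tiles_from N T x' (y + 1))"
proof -
  have "strip 0 (Suc x) (y + 1) \<subseteq> strip 0 (N - (y + 1)) (y + 1)"
    using xy by (auto simp: strip_def)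
  from exists_tiling_with_row_part[OF T A this] xy
  obtain T' where T': "T' \<in> tilings N" "tiles_in T' (strip 0 (Suc x) (y + 1)) = A"
    "\<forall>\<tau>\<in>T'. \<tau> \<inter> strip 0 (Suc x) (y + 1) = {} \<or> \<tau> \<subseteq> strip 0 (Suc x) (y + 1)"
    "\<And>\<tau>. \<tau> \<subseteq> UNIV \<times> {y + 1<..} \<Longrightarrow> \<tau> \<in> T' \<longleftrightarrow> \<tau> \<in> T" by auto
  have "left_tiles T' (Suc x) (y + 1) = A"
    using left_tiles_eq[OF T'(1)] T'(2) by simp
  moreover have "domino (Suc x) (y + 1) \<notin> T'"
    using domino_notin_if_uncrossed[OF T'(3)] by simp
  moreover have "path_from N T' x' (y + 1) = path_from N T x' (y + 1)"
    and "tiles_from N T' x' (y + 1) = tiles_from N T x' (y + 1)" for x'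
    by (intro path_from_cong tiles_from_cong T'(4); assumption)+
  ultimately show ?thesis using T'(1) by blast
qed

lemma exists_tiling_with_right_part:
  assumes T: "T \<in> tilings N" and A: "A \<in> tilings_of (strip x (N - (y + 1)) (y + 1))"
    and xy: "Suc x + y < N"
  shows "\<exists>T'\<in>tilings N. right_tiles T' x (y + 1) = A \<and>
    (\<forall>x'. path_from N T' x' (y + 1) = path_from N T x' (y + 1) \<and>
          tiles_from N T' x' (y + 1) = tiles_from N T x' (y + 1))"
proof -
  have "strip x (N - (y + 1)) (y + 1) \<subseteq> strip 0 (N - (y + 1)) (y + 1)"
    by (auto simp: strip_def)
  from exists_tiling_with_row_part[OF T A this] xy
  obtain T' where T': "T' \<in> tilings N" "tiles_in T' (strip x (N - (y + 1)) (y + 1)) = A"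
    "\<And>\<tau>. \<tau> \<subseteq> UNIV \<times> {y + 1<..} \<Longrightarrow> \<tau> \<in> T' \<longleftrightarrow> \<tau> \<in> T" by auto
  have "right_tiles T' x (y + 1) = A"
    using right_tiles_eq[OF T'(1)] T'(2) by simp
  moreover have "path_from N T' x' (y + 1) = path_from N T x' (y + 1)"
    and "tiles_from N T' x' (y + 1) = tiles_from N T x' (y + 1)" for x'
    by (intro path_from_cong tiles_from_cong T'(3); assumption)+
  ultimately show ?thesis using T'(1) by blast
qed

text \<open>
  No tile straddles the north step, so the tiles on its left cover the boxes on its left exactly.
\<close>

lemma left_tiles_tiling:
  assumes T: "T \<in> tilings N" and "domino (Suc x) (y + 1) \<notin> T" "Suc x + y < N"
  shows "left_tiles T (Suc x) (y + 1) \<in> tilings_of (strip 0 (Suc x) (y + 1))"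
  unfolding left_tiles_eq[OF T]
proof (rule tiles_in_tiling[OF T[unfolded tilings_eq]])
  show "strip 0 (Suc x) (y + 1) \<subseteq> staircase N"
    using assms(3) by (auto simp: strip_def staircase_def)
  fix \<tau> assume \<tau>: "\<tau> \<in> T"
  note tile = tilings_ofD(4)[OF T[unfolded tilings_eq] \<tau>]
  show "\<tau> \<inter> strip 0 (Suc x) (y + 1) = {} \<or> \<tau> \<subseteq> strip 0 (Suc x) (y + 1)"
  proof (cases "is_monomino \<tau>")
    case True
    then show ?thesis by (auto simp: is_monomino_def monomino_def)
  next
    case False
    with tile obtain c r where d: "\<tau> = domino c r" by (auto simp: is_domino_def)
    have "(c, r) \<in> \<tau>" by (simp add: d domino_def)
    then have "1 \<le> c" using tiling_tile_bounds(3)[OF T \<tau>] by blast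
    moreover have "\<not> (c = Suc x \<and> r = y + 1)" using d \<tau> assms(2) by blast
    ultimately show ?thesis by (auto simp: d domino_def strip_def)
  qed
qed

text \<open>
  No tile straddles the north step at \<open>x\<close> either, because the blocking domino begins in column
  \<open>x + 1\<close>.
\<close>

lemma right_tiles_tiling:
  assumes T: "T \<in> tilings N" and dom: "domino (Suc x) (y + 1) \<in> T"
  shows "right_tiles T x (y + 1) \<in> tilings_of (strip x (N - (y + 1)) (y + 1))"
    and "domino (Suc x) (y + 1) \<in> right_tiles T x (y + 1)"
    and "Suc x + y < N"
proof -
  have "(Suc x + 1, y + 1) \<in> domino (Suc x) (y + 1)" by (simp add: domino_def)
  from tiling_tile_bounds[OF T dom this] show xy: "Suc x + y < N" by simp
  show "domino (Suc x) (y + 1) \<in> right_tiles T x (y + 1)"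
    using dom by (auto simp: right_tiles_def domino_def)
  show "right_tiles T x (y + 1) \<in> tilings_of (strip x (N - (y + 1)) (y + 1))"
    unfolding right_tiles_eq[OF T]
  proof (rule tiles_in_tiling[OF T[unfolded tilings_eq]])
    show "strip x (N - (y + 1)) (y + 1) \<subseteq> staircase N"
      using xy by (auto simp: strip_def staircase_def)
    fix \<tau> assume \<tau>: "\<tau> \<in> T"
    note tile = tilings_ofD(4)[OF T[unfolded tilings_eq] \<tau>]
    show "\<tau> \<inter> strip x (N - (y + 1)) (y + 1) = {} \<or> \<tau> \<subseteq> strip x (N - (y + 1)) (y + 1)"
    proof (cases "is_monomino \<tau>")
      case True
      then show ?thesis by (auto simp: is_monomino_def monomino_def)
    next
      case False
      with tile obtain c r where d: "\<tau> = domino c r" by (auto simp: is_domino_def)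
      have "(c + 1, r) \<in> \<tau>" by (simp add: d domino_def)
      then have "c + 1 + r \<le> N" using tiling_tile_bounds(4)[OF T \<tau>] by blast
      moreover have "\<not> (c = x \<and> r = y + 1)"
      proof
        assume "c = x \<and> r = y + 1"
        with d have "\<tau> = domino x (y + 1)" by simp
        moreover from this have "\<tau> \<inter> domino (Suc x) (y + 1) \<noteq> {}" by (auto simp: domino_def)
        with tilings_ofD(5)[OF T[unfolded tilings_eq] \<tau> dom]
        have "\<tau> = domino (Suc x) (y + 1)" by simp
        ultimately show False by (auto simp: domino_def doubleton_eq_iff)
      qed
      ultimately show ?thesis by (auto simp: d domino_def strip_def)
    qed
  qed
qed

text \<open>
  Either the path goes north at once and the row contributes an arbitrary tiling of the boxes on the
  left, or it is blocked by a domino, steps west, and the row contributes a tiling of the boxes on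
  the right of its new position that begins with this domino.
\<close>

lemma partial_tilings_step:
  assumes xy: "Suc x + y < N"
  shows "partial_tilings N (Suc x) y =
      prepend [North] (tilings_of (strip 0 (Suc x) (y + 1))) (partial_tilings N (Suc x) (y + 1)) \<union>
      prepend [West, North]
        {A. A \<in> tilings_of (strip x (N - (y + 1)) (y + 1)) \<and> domino (Suc x) (y + 1) \<in> A}
        (partial_tilings N x (y + 1))"
    (is "?L = ?N \<union> ?W")
proof (intro equalityI subsetI)
  fix C assume "C \<in> ?L"
  then obtain T where T: "T \<in> tilings N" and C: "C = (path_from N T (Suc x) y, tiles_from N T (Suc x) y)"
    by (auto simp: partial_tilings_def)
  show "C \<in> ?N \<union> ?W"
  proof (cases "domino (Suc x) (y + 1) \<in> T")
    case True
    note W = path_from_West[OF T, of x y] tiles_from_West[of x y N T]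
    have "C = ([West, North] @ path_from N T x (y + 1), right_tiles T x (y + 1) \<union> tiles_from N T x (y + 1))"
      using W True xy C by simp
    also have "\<dots> \<in> ?W"
      using right_tiles_tiling[OF T True] T by (intro prependI) (auto simp: partial_tilings_def)
    finally have "C \<in> ?W" .
    then show ?thesis by blast
  next
    case False
    have "C = ([North] @ path_from N T (Suc x) (y + 1),
        left_tiles T (Suc x) (y + 1) \<union> tiles_from N T (Suc x) (y + 1))"
      using path_from_North[OF False xy] tiles_from_North[OF False xy] C by simp
    also have "\<dots> \<in> ?N"
      using left_tiles_tiling[OF T False xy] T by (intro prependI) (auto simp: partial_tilings_def)
    finally have "C \<in> ?N" .
    then show ?thesis by blast
  qed
next
  fix C assume "C \<in> ?N \<union> ?W"
  then show "C \<in> ?L"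
  proof
    assume "C \<in> ?N"
    then obtain A p B where A: "A \<in> tilings_of (strip 0 (Suc x) (y + 1))"
      and pB: "(p, B) \<in> partial_tilings N (Suc x) (y + 1)" and C: "C = ([North] @ p, A \<union> B)"
      by (rule prependE)
    from pB obtain T where T: "T \<in> tilings N" "p = path_from N T (Suc x) (y + 1)"
      "B = tiles_from N T (Suc x) (y + 1)"
      by (auto simp: partial_tilings_def)
    obtain T' where T': "T' \<in> tilings N" "left_tiles T' (Suc x) (y + 1) = A" "domino (Suc x) (y + 1) \<notin> T'"
      "path_from N T' (Suc x) (y + 1) = path_from N T (Suc x) (y + 1)"
      "tiles_from N T' (Suc x) (y + 1) = tiles_from N T (Suc x) (y + 1)"
      using exists_tiling_with_left_part[OF T(1) A xy] by blast
    have "C = (path_from N T' (Suc x) y, tiles_from N T' (Suc x) y)"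
      unfolding C T(2,3) path_from_North[OF T'(3) xy] tiles_from_North[OF T'(3) xy] T' by simp
    then show ?thesis using T'(1) unfolding partial_tilings_def by blast
  next
    assume "C \<in> ?W"
    then obtain A p B where "A \<in> {A. A \<in> tilings_of (strip x (N - (y + 1)) (y + 1)) \<and>
        domino (Suc x) (y + 1) \<in> A}"
      and pB: "(p, B) \<in> partial_tilings N x (y + 1)" and C: "C = ([West, North] @ p, A \<union> B)"
      by (rule prependE)
    then have A: "A \<in> tilings_of (strip x (N - (y + 1)) (y + 1))"
      and d: "domino (Suc x) (y + 1) \<in> A" by auto
    from pB obtain T where T: "T \<in> tilings N" "p = path_from N T x (y + 1)"
      "B = tiles_from N T x (y + 1)"
      by (auto simp: partial_tilings_def)
    obtain T' where T': "T' \<in> tilings N" "right_tiles T' x (y + 1) = A"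
      "path_from N T' x (y + 1) = path_from N T x (y + 1)"
      "tiles_from N T' x (y + 1) = tiles_from N T x (y + 1)"
      using exists_tiling_with_right_part[OF T(1) A xy] by blast
    have d': "domino (Suc x) (y + 1) \<in> T' \<or> Suc x + y = N"
      using d T'(2) by (auto simp: right_tiles_def)
    have "Suc x + y \<le> N" using xy by simp
    then have "C = (path_from N T' (Suc x) y, tiles_from N T' (Suc x) y)"
      using d' C T(2,3) T' path_from_West[OF T'(1) _ d'] tiles_from_West[OF _ d'] by simp
    then show ?thesis using T'(1) unfolding partial_tilings_def by blast
  qed
qed

lemma prepend_empty: "prepend us {{}} S = (\<lambda>(p, B). (us @ p, B)) ` S"
proof -
  have eq: "{{}} \<times> S = Pair {} ` S" by auto
  show ?thesis unfolding prepend_def eq image_image case_prod_unfold by simp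
qed

text \<open>
  On the boundary the west step leads to the end of the row, where nothing is left to be tiled.
\<close>

lemma partial_tilings_forced_West:
  assumes "Suc x + y = N"
  shows "partial_tilings N (Suc x) y = prepend [West, North] {{}} (partial_tilings N x (y + 1))"
proof -
  have "right_tiles T x (y + 1) = {}" if T: "T \<in> tilings N" for T
  proof -
    have "strip x (N - (y + 1)) (y + 1) = {}" using assms by (simp add: strip_def)
    then show ?thesis
      using tilings_ofD(2)[OF T[unfolded tilings_eq]] unfolding right_tiles_eq[OF T] tiles_in_def by auto
  qed
  then show ?thesis
    unfolding prepend_empty partial_tilings_def image_image
    using assms by (intro image_cong) (simp_all add: path_from_West tiles_from_West)
qed

lemma partial_tilings_0:
  assumes "y < N"
  shows "partial_tilings N 0 y = prepend [North] {{}} (partial_tilings N 0 (y + 1))"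
  unfolding prepend_empty partial_tilings_def image_image
  using assms by (intro image_cong) (simp_all add: path_from_0[of N _ y] tiles_from_0)

lemma tilings_nonempty: "tilings N \<noteq> {}"
  using monominoes_tiling[of "staircase N"] unfolding tilings_eq by blast

lemma partial_tilings_end: "partial_tilings N 0 N = {([], {})}"
  using tilings_nonempty[of N] by (auto simp: partial_tilings_def path_from_0[of N _ N] tiles_from_0)

section \<open>Total weights\<close>

definition weight :: "(step list \<times> tile set) set \<Rightarrow> st_poly" where
  "weight S = (\<Sum>C\<in>S. wt C)"

text \<open>
  The tiles of the new row can be recognised in \<open>A \<union> B\<close> by their height. Therefore a pair \<open>(A, B)\<close> is
  determined by its union, and the sum over \<open>prepend us \<A> S\<close> is a product of two sums.
\<close>

lemma weight_prepend:
  assumes "finite \<A>" "finite S"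
    and A: "\<And>A. A \<in> \<A> \<Longrightarrow> finite A" "\<And>A \<tau>. A \<in> \<A> \<Longrightarrow> \<tau> \<in> A \<Longrightarrow> \<tau> \<noteq> {} \<and> \<tau> \<subseteq> UNIV \<times> {r}"
    and B: "\<And>p B. (p, B) \<in> S \<Longrightarrow> finite B" "\<And>p B \<tau>. (p, B) \<in> S \<Longrightarrow> \<tau> \<in> B \<Longrightarrow> \<tau> \<subseteq> UNIV \<times> {r<..}"
  shows "weight (prepend us \<A> S) = (\<Sum>A\<in>\<A>. wt (us, A)) * weight S"
proof -
  have above: "\<not> (\<tau> \<noteq> {} \<and> \<tau> \<subseteq> UNIV \<times> {r})" if "(p, B) \<in> S" "\<tau> \<in> B" for p B \<tau>
    using B(2)[OF that] by fastforce
  have disj: "A \<inter> B = {}" if "A \<in> \<A>" "(p, B) \<in> S" for A p B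
    using A(2)[OF that(1)] above[OF that(2)] by blast
  have part: "{\<tau> \<in> A \<union> B. \<tau> \<noteq> {} \<and> \<tau> \<subseteq> UNIV \<times> {r}} = A" if "A \<in> \<A>" "(p, B) \<in> S" for A p B
    using A(2)[OF that(1)] above[OF that(2)] by blast
  have inj: "inj_on (\<lambda>(A, p, B). (us @ p, A \<union> B)) (\<A> \<times> S)"
  proof (rule inj_onI, clarsimp)
    fix A A' p B B'
    assume *: "A \<in> \<A>" "A' \<in> \<A>" "(p, B) \<in> S" "(p, B') \<in> S" "A \<union> B = A' \<union> B'"
    then have AA': "A = A'" 
      using part[OF *(1,3)] part[OF *(2,4)] by simp
    moreover have "B = (A \<union> B) - A" "B' = (A' \<union> B') - A'"
      using disj * by blast+
    ultimately show "A = A' \<and> B = B'" using *(5) by simp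
  qed
  have "weight (prepend us \<A> S) = (\<Sum>(A, p, B)\<in>\<A> \<times> S. wt (us @ p, A \<union> B))"
    unfolding weight_def prepend_def by (subst sum.reindex[OF inj]) (simp add: case_prod_unfold)
  also have "\<dots> = (\<Sum>(A, C)\<in>\<A> \<times> S. wt (us, A) * wt C)"
  proof (rule sum.cong)
    fix z assume "z \<in> \<A> \<times> S"
    then obtain A p B where z: "z = (A, p, B)" "A \<in> \<A>" "(p, B) \<in> S" by (cases z) auto
    have "wt (us @ p, A \<union> B) = wt (us, A) * wt (p, B)"
      by (rule wt_Un[OF A(1)[OF z(2)] B(1)[OF z(3)] disj[OF z(2,3)]])
    then show "(case z of (A, p, B) \<Rightarrow> wt (us @ p, A \<union> B)) = (case z of (A, C) \<Rightarrow> wt (us, A) * wt C)"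
      by (simp add: z)
  qed simp
  also have "\<dots> = (\<Sum>A\<in>\<A>. wt (us, A)) * weight S"
    unfolding weight_def sum_product sum.cartesian_product ..
  finally show ?thesis .
qed

lemma finite_partial_tilings: "finite (partial_tilings N x y)"
  by (simp add: partial_tilings_def finite_tilings)

lemma partial_tilings_tiles:
  assumes "(p, B) \<in> partial_tilings N x y"
  shows "finite B" and "\<And>\<tau>. \<tau> \<in> B \<Longrightarrow> \<tau> \<subseteq> UNIV \<times> {y<..}"
proof -
  obtain T where T: "T \<in> tilings N" and B: "B = tiles_from N T x y"
    using assms by (auto simp: partial_tilings_def)
  show "\<tau> \<subseteq> UNIV \<times> {y<..}" if "\<tau> \<in> B" for \<tau>
    using tiles_from_rows[OF T] that B by blast
  have "finite T" using finite_tiling T finite_staircase by (simp add: tilings_eq)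
  then show "finite B"
    by (rule finite_subset[rotated]) (use tiles_from_rows[OF T] B in blast)
qed

lemma weight_prepend_strip:
  assumes "\<A> \<subseteq> tilings_of (strip a b (y + 1))"
  shows "weight (prepend us \<A> (partial_tilings N x (y + 1))) =
    (\<Sum>A\<in>\<A>. wt (us, A)) * weight (partial_tilings N x (y + 1))"
proof (rule weight_prepend[where r = "y + 1"])
  show "finite \<A>" by (rule finite_subset[OF assms]) (simp add: finite_tilings_of)
  fix A assume "A \<in> \<A>"
  with assms have A: "A \<in> tilings_of (strip a b (y + 1))" by blast
  show "finite A" by (rule finite_tiling[OF A]) simp
  show "\<tau> \<noteq> {} \<and> \<tau> \<subseteq> UNIV \<times> {y + 1}" if "\<tau> \<in> A" for \<tau>
    using tilings_ofD(2,3)[OF A that] by (auto simp: strip_def)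
next
  fix p B assume pB: "(p, B) \<in> partial_tilings N x (y + 1)"
  show "finite B" by (rule partial_tilings_tiles(1)[OF pB])
  show "\<tau> \<subseteq> UNIV \<times> {y + 1<..}" if "\<tau> \<in> B" for \<tau>
    by (rule partial_tilings_tiles(2)[OF pB that])
qed (rule finite_partial_tilings)

lemma weight_prepend_empty:
  "weight (prepend us {{}} (partial_tilings N x (y + 1))) = weight (partial_tilings N x (y + 1))"
proof -
  have "{{}} \<subseteq> tilings_of (strip 0 0 (y + 1))" by (simp add: strip_def tilings_of_empty)
  from weight_prepend_strip[OF this] show ?thesis by simp
qed

lemma weight_partial_tilings_step:
  assumes "Suc x + y < N"
  shows "weight (partial_tilings N (Suc x) y) =
    lucas (x + 2) * weight (partial_tilings N (Suc x) (y + 1)) +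
    var_t * lucas (N - (y + 1) - Suc x) * weight (partial_tilings N x (y + 1))"
proof -
  let ?N = "prepend [North] (tilings_of (strip 0 (Suc x) (y + 1))) (partial_tilings N (Suc x) (y + 1))"
  let ?D = "{A. A \<in> tilings_of (strip x (N - (y + 1)) (y + 1)) \<and> domino (Suc x) (y + 1) \<in> A}"
  let ?W = "prepend [West, North] ?D (partial_tilings N x (y + 1))"
  have "finite (?N \<union> ?W)"
    using finite_partial_tilings[of N "Suc x" y] unfolding partial_tilings_step[OF assms] .
  moreover have "?N \<inter> ?W = {}" by (auto elim!: prependE)
  ultimately have "weight (partial_tilings N (Suc x) y) = weight ?N + weight ?W"
    unfolding partial_tilings_step[OF assms] weight_def by (subst sum.union_disjoint) auto
  moreover have "weight ?N = lucas (x + 2) * weight (partial_tilings N (Suc x) (y + 1))"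
    by (subst weight_prepend_strip[OF subset_refl]) (simp add: sum_wt_strip)
  moreover have "weight ?W = var_t * lucas (N - (y + 1) - Suc x) * weight (partial_tilings N x (y + 1))"
  proof -
    have "?D \<subseteq> tilings_of (strip x (N - (y + 1)) (y + 1))" by blast
    moreover have "x < N - (y + 1)" using assms by simp
    ultimately show ?thesis
      by (simp only: weight_prepend_strip sum_wt_strip_domino_first_lucas)
  qed
  ultimately show ?thesis by simp
qed

text \<open>
  In terms of tilings of a row with \<open>m + n\<close> boxes: either the row breaks after box \<open>m\<close>, or a domino
  covers the boxes \<open>m\<close> and \<open>m + 1\<close>.
\<close>

lemma lucas_add: "lucas (Suc (m + n)) = lucas (Suc m) * lucas (Suc n) + var_t * lucas m * lucas n"
proof (induction m rule: lucas.induct)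
  case (3 m)
  have "lucas (Suc (Suc (Suc m) + n)) = var_s * lucas (Suc (Suc m + n)) + var_t * lucas (Suc (m + n))"
    by simp
  also have "\<dots> = lucas (Suc (Suc (Suc m))) * lucas (Suc n) + var_t * lucas (Suc (Suc m)) * lucas n"
    unfolding 3 by (simp add: algebra_simps)
  finally show ?case .
qed simp_all

lemma lucas_fact_0 [simp]: "lucas_fact 0 = 1"
  and lucas_fact_Suc: "lucas_fact (Suc n) = lucas_fact n * lucas (Suc n)"
  by (simp_all add: lucas_fact_def)

text \<open>
  This says that the weight of the partial tilings from \<open>(x, y)\<close> is the lucasnomial
  \<open>{N - y choose x}\<close>, with denominators cleared. The induction runs from the top row downwards:
  \<open>weight_partial_tilings_step\<close> is the Pascal recursion of the lucasnomials, which holds because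
  of \<open>lucas_add\<close>.
\<close>

lemma weight_partial_tilings:
  assumes "x + y \<le> N"
  shows "weight (partial_tilings N x y) * (lucas_fact x * lucas_fact (N - y - x)) = lucas_fact (N - y)"
  using assms
proof (induction "N - y" arbitrary: x y)
  case 0
  then have "x = 0" "y = N" by auto
  then show ?case by (simp add: partial_tilings_end weight_def)
next
  case (Suc k)
  then have k: "k = N - (y + 1)" by simp
  note IH = Suc.hyps(1)[OF k]
  show ?case
  proof (cases x)
    case 0
    from Suc.hyps(2) have y: "y < N" and Ny: "N - y = Suc (N - (y + 1))" by auto
    have "weight (partial_tilings N 0 (y + 1)) * lucas_fact (N - (y + 1)) = lucas_fact (N - (y + 1))"
      using IH[of 0] y by simp
    then show ?thesis
      unfolding 0 partial_tilings_0[OF y] weight_prepend_empty Ny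
      by (simp add: lucas_fact_Suc mult.assoc[symmetric])
  next
    case (Suc z)
    show ?thesis
    proof (cases "Suc z + y = N")
      case True
      have "weight (partial_tilings N z (y + 1)) * (lucas_fact z * lucas_fact (N - (y + 1) - z)) =
          lucas_fact (N - (y + 1))"
        using True by (intro IH) simp
      moreover have "N - (y + 1) = z" "N - y = Suc z" using True by auto
      ultimately show ?thesis
        unfolding Suc partial_tilings_forced_West[OF True] weight_prepend_empty
        by (simp add: lucas_fact_Suc mult.assoc[symmetric])
    next
      case False
      with Suc.prems Suc have xy: "Suc z + y < N" by simp
      (* d boxes of the row lie to the right of the path, that is N - (y + 1) = Suc z + d. *)
      define d where "d = N - (y + 1) - Suc z"
      let ?G1 = "weight (partial_tilings N (Suc z) (y + 1))"
      let ?G2 = "weight (partial_tilings N z (y + 1))"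
      let ?F = "lucas_fact (N - (y + 1))"
      have d: "N - (y + 1) - z = Suc d" "N - y - Suc z = Suc d" "N - y = Suc (N - (y + 1))"
        "N - y = Suc (Suc z + d)"
        using xy by (auto simp: d_def)
      have 1: "?G1 * (lucas_fact (Suc z) * lucas_fact d) = ?F"
        unfolding d_def using xy by (intro IH) simp
      have 2: "?G2 * (lucas_fact z * lucas_fact (Suc d)) = ?F"
        unfolding d(1)[symmetric] using xy by (intro IH) simp
      have "weight (partial_tilings N (Suc z) y) * (lucas_fact (Suc z) * lucas_fact (Suc d)) =
        lucas (z + 2) * lucas (Suc d) * (?G1 * (lucas_fact (Suc z) * lucas_fact d)) +
        var_t * lucas (Suc z) * lucas d * (?G2 * (lucas_fact z * lucas_fact (Suc d)))"
        unfolding weight_partial_tilings_step[OF xy] d_def[symmetric] lucas_fact_Suc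
        by (simp only: algebra_simps)
      also have "\<dots> = ?F * lucas (Suc (Suc z + d))"
        unfolding 1 2 lucas_add by (simp add: algebra_simps del: lucas.simps)
      also have "\<dots> = lucas_fact (N - y)"
        unfolding d(3) lucas_fact_Suc using d(3,4) by simp
      finally show ?thesis by (simp only: Suc d(2))
    qed
  qed
qed

section \<open>Catalan partial tilings\<close>

text \<open>
  The bottom row contributes at most one domino, and from height \<open>1\<close> on a Catalan partial tiling is
  an ordinary partial tiling of the rows above.
\<close>

lemma catalan_partial_tiling_North:
  assumes T: "T \<in> tilings (2 * n)" and n: "1 \<le> n"
    and path: "path_from (2 * n) T (n - 1) 0 = North # path_from (2 * n) T (n - 1) 1"
  shows "catalan_partial_tiling n T =
    ([North] @ path_from (2 * n) T (n - 1) 1, {} \<union> tiles_from (2 * n) T (n - 1) 1)"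
proof -
  have "upper_tiles_along n T [North] (path_from (2 * n) T (n - 1) 1) = tiles_from (2 * n) T (n - 1) 1"
    using n by (intro upper_tiles_along_path[OF T]) (auto simp: is_NL_def)
  then show ?thesis
    unfolding catalan_partial_tiling_def catalan_path_def path Let_def upper_row_tiles_eq
    by (simp add: first_row_tiles_def north_step_tiles_def)
qed

lemma catalan_partial_tiling_West:
  assumes T: "T \<in> tilings (2 * n)" and n: "n = Suc (Suc x)"
    and dom: "domino (Suc x) 1 \<in> T"
  shows "catalan_partial_tiling n T =
    ([West, North] @ path_from (2 * n) T x 1, {domino (Suc x) 1} \<union> tiles_from (2 * n) T x 1)"
proof -
  have "upper_tiles_along n T [West, North] (path_from (2 * n) T x 1) = tiles_from (2 * n) T x 1"
    using n by (intro upper_tiles_along_path[OF T]) (auto simp: is_NL_def)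
  moreover have "path_from (2 * n) T (Suc x) 0 = West # North # path_from (2 * n) T x 1"
    using path_from_West[OF T, of x 0] dom n by simp
  ultimately show ?thesis
    using n by (simp add: catalan_partial_tiling_def catalan_path_def Let_def first_row_tiles_def
        upper_row_tiles_eq north_step_tiles_def)
qed

lemma catalan_partial_tilings_1: "catalan_partial_tilings 1 = prepend [North] {{}} (partial_tilings 2 0 1)"
proof -
  have "catalan_partial_tiling 1 T = ([North] @ path_from 2 T 0 1, tiles_from 2 T 0 1)"
    if "T \<in> tilings 2" for T
    using catalan_partial_tiling_North[of T 1] that by (simp add: path_from_0[of 2 T 0])
  then show ?thesis
    unfolding catalan_partial_tilings_def prepend_empty partial_tilings_def image_image
    by (intro image_cong) simp_all
qed

lemma catalan_partial_tilings_Suc_Suc: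
  assumes n: "n = Suc (Suc x)"
  shows "catalan_partial_tilings n =
    prepend [North] {{}} (partial_tilings (2 * n) (Suc x) 1) \<union>
    prepend [West, North] {{domino (Suc x) 1}} (partial_tilings (2 * n) x 1)"
    (is "_ = ?N \<union> ?W")
proof (intro equalityI subsetI)
  fix C assume "C \<in> catalan_partial_tilings n"
  then obtain T where T: "T \<in> tilings (2 * n)" and C: "C = catalan_partial_tiling n T"
    by (auto simp: catalan_partial_tilings_def)
  show "C \<in> ?N \<union> ?W"
  proof (cases "domino (Suc x) 1 \<in> T")
    case True
    have "C \<in> ?W"
      unfolding C catalan_partial_tiling_West[OF T n True]
      using T by (intro prependI) (auto simp: partial_tilings_def)
    then show ?thesis by blast
  next
    case False
    then have "path_from (2 * n) T (n - 1) 0 = North # path_from (2 * n) T (n - 1) 1"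
      using path_from_North[of x 0 T "2 * n"] n by simp
    from catalan_partial_tiling_North[OF T _ this] n
    have "C = ([North] @ path_from (2 * n) T (Suc x) 1, {} \<union> tiles_from (2 * n) T (Suc x) 1)"
      using C by simp
    also have "\<dots> \<in> ?N"
      using T by (intro prependI) (auto simp: partial_tilings_def)
    finally show ?thesis by blast
  qed
next
  have xN: "Suc x + 0 < 2 * n" using n by simp
  fix C assume "C \<in> ?N \<union> ?W"
  then show "C \<in> catalan_partial_tilings n"
  proof
    assume "C \<in> ?N"
    then obtain T where T: "T \<in> tilings (2 * n)"
      and C: "C = ([North] @ path_from (2 * n) T (Suc x) 1, {} \<union> tiles_from (2 * n) T (Suc x) 1)"
      by (auto elim!: prependE simp: partial_tilings_def)
    obtain T' where T': "T' \<in> tilings (2 * n)" "domino (Suc x) 1 \<notin> T'"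
      "path_from (2 * n) T' (Suc x) 1 = path_from (2 * n) T (Suc x) 1"
      "tiles_from (2 * n) T' (Suc x) 1 = tiles_from (2 * n) T (Suc x) 1"
      using exists_tiling_with_left_part[OF T monominoes_tiling xN] by auto
    have "path_from (2 * n) T' (n - 1) 0 = North # path_from (2 * n) T' (n - 1) 1"
      using path_from_North[of x 0 T' "2 * n"] T'(2) n by simp
    from catalan_partial_tiling_North[OF T'(1) _ this] n
    have "C = catalan_partial_tiling n T'" using C T' by simp
    then show ?thesis using T'(1) by (auto simp: catalan_partial_tilings_def)
  next
    assume "C \<in> ?W"
    then obtain T where T: "T \<in> tilings (2 * n)"
      and C: "C = ([West, North] @ path_from (2 * n) T x 1, {domino (Suc x) 1} \<union> tiles_from (2 * n) T x 1)"
      by (auto elim!: prependE simp: partial_tilings_def)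
    let ?M = "(\<lambda>b. {b}) ` (strip x (2 * n - 1) 1 - domino (Suc x) 1)"
    have "{domino (Suc x) 1} \<in> tilings_of (domino (Suc x) 1)"
      by (rule tilings_ofI) auto
    then have "{domino (Suc x) 1} \<union> ?M \<in> tilings_of (domino (Suc x) 1 \<union> (strip x (2 * n - 1) 1 - domino (Suc x) 1))"
      by (rule tilings_of_Un[OF _ monominoes_tiling]) blast
    moreover have "domino (Suc x) 1 \<union> (strip x (2 * n - 1) 1 - domino (Suc x) 1) = strip x (2 * n - 1) 1"
      using n by (auto simp: domino_def strip_def)
    ultimately have A: "{domino (Suc x) 1} \<union> ?M \<in> tilings_of (strip x (2 * n - (0 + 1)) (0 + 1))"
      by simp
    obtain T' where T': "T' \<in> tilings (2 * n)" "right_tiles T' x 1 = {domino (Suc x) 1} \<union> ?M"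
      "path_from (2 * n) T' x 1 = path_from (2 * n) T x 1"
      "tiles_from (2 * n) T' x 1 = tiles_from (2 * n) T x 1"
      using exists_tiling_with_right_part[OF T A xN] by auto
    have "domino (Suc x) 1 \<in> right_tiles T' x 1" unfolding T'(2) by blast
    then have "domino (Suc x) 1 \<in> T'" by (simp add: right_tiles_def)
    from catalan_partial_tiling_West[OF T'(1) n this]
    have "C = catalan_partial_tiling n T'" using C T' by simp
    then show ?thesis using T'(1) by (auto simp: catalan_partial_tilings_def)
  qed
qed

lemma weight_catalan_partial_tilings_Suc_Suc:
  assumes n: "n = Suc (Suc x)"
  shows "weight (catalan_partial_tilings n) =
    weight (partial_tilings (2 * n) (Suc x) 1) + var_t * weight (partial_tilings (2 * n) x 1)"
proof -
  let ?N = "prepend [North] {{}} (partial_tilings (2 * n) (Suc x) 1)"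
  let ?W = "prepend [West, North] {{domino (Suc x) 1}} (partial_tilings (2 * n) x 1)"
  have "finite (?N \<union> ?W)"
    using finite_catalan_partial_tilings[of n] unfolding catalan_partial_tilings_Suc_Suc[OF n] .
  moreover have "?N \<inter> ?W = {}" by (auto elim!: prependE)
  ultimately have "weight (catalan_partial_tilings n) = weight ?N + weight ?W"
    unfolding catalan_partial_tilings_Suc_Suc[OF n] weight_def by (subst sum.union_disjoint) auto
  moreover have "weight ?N = weight (partial_tilings (2 * n) (Suc x) 1)"
    using weight_prepend_empty[of _ _ _ 0] by simp
  moreover have "weight ?W = var_t * weight (partial_tilings (2 * n) x 1)"
  proof -
    have "weight ?W = (\<Sum>A\<in>{{domino (Suc x) 1}}. wt ([West, North], A)) * weight (partial_tilings (2 * n) x 1)"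
    proof (rule weight_prepend[where r = 1])
      fix p B assume pB: "(p, B) \<in> partial_tilings (2 * n) x 1"
      show "finite B" by (rule partial_tilings_tiles(1)[OF pB])
      show "\<tau> \<subseteq> UNIV \<times> {1<..}" if "\<tau> \<in> B" for \<tau>
        by (rule partial_tilings_tiles(2)[OF pB that])
    qed (auto simp: domino_def finite_partial_tilings)
    then show ?thesis by (simp add: wt_domino)
  qed
  ultimately show ?thesis by simp
qed

text \<open>
  Let \<open>{i}\<close> denote \<open>lucas i\<close>. For \<open>n \<ge> 2\<close> the two lucasnomials \<open>{2 n - 1 choose n - 1}\<close> and
  \<open>{2 n - 1 choose n - 2}\<close>, multiplied by \<open>{n}! {n + 1}!\<close>, become \<open>{2 n - 1}! {n} {n + 1}\<close> and
  \<open>{2 n - 1}! {n} {n - 1}\<close>. By \<open>lucas_add\<close>, \<open>{n} {n + 1} + t {n - 1} {n} = {2 n}\<close>. For \<open>n \<le> 1\<close> the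
  path cannot begin with a west step, and there is only one Catalan partial tiling.
\<close>

lemma weight_catalan_partial_tilings:
  "weight (catalan_partial_tilings n) * (lucas_fact n * lucas_fact (n + 1)) = lucas_fact (2 * n)"
proof -
  consider "n = 0" | "n = 1" | x where "n = Suc (Suc x)" by (cases n rule: lucas.cases) auto
  then show ?thesis
  proof cases
    case 1
    have "catalan_partial_tiling 0 T = ([], {})" for T
      by (simp add: catalan_partial_tiling_def catalan_path_def path_from_0 first_row_tiles_def
          upper_row_tiles_eq)
    then have "catalan_partial_tilings 0 = {([], {})}"
      using tilings_nonempty[of 0] by (auto simp: catalan_partial_tilings_def)
    then show ?thesis using 1 by (simp add: weight_def lucas_fact_Suc)
  next
    case 2
    have "weight (catalan_partial_tilings 1) = weight (partial_tilings 2 0 1)"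
      unfolding catalan_partial_tilings_1 using weight_prepend_empty[of _ _ _ 0] by simp
    also have "\<dots> = 1"
      using weight_partial_tilings[of 0 1 2] by (simp add: lucas_fact_Suc)
    finally show ?thesis using 2 by (simp add: lucas_fact_Suc numeral_2_eq_2)
  next
    case (3 x)
    let ?G1 = "weight (partial_tilings (2 * n) (Suc x) 1)"
    let ?G2 = "weight (partial_tilings (2 * n) x 1)"
    let ?F = "lucas_fact (2 * n - 1)"
    have d: "2 * n - 1 - Suc x = n" "2 * n - 1 - x = Suc n" using 3 by auto
    have 1: "?G1 * (lucas_fact (Suc x) * lucas_fact n) = ?F"
      using weight_partial_tilings[of "Suc x" 1 "2 * n"] 3 unfolding d by simp
    have 2: "?G2 * (lucas_fact x * lucas_fact (Suc n)) = ?F"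
      using weight_partial_tilings[of x 1 "2 * n"] 3 unfolding d by simp
    have n: "lucas_fact n = lucas_fact x * lucas (Suc x) * lucas n"
      using 3 by (simp only: lucas_fact_Suc)
    have "weight (catalan_partial_tilings n) * (lucas_fact n * lucas_fact (Suc n)) =
       lucas n * lucas (Suc n) * (?G1 * (lucas_fact (Suc x) * lucas_fact n)) +
       var_t * lucas (Suc x) * lucas n * (?G2 * (lucas_fact x * lucas_fact (Suc n)))"
      unfolding weight_catalan_partial_tilings_Suc_Suc[OF 3] lucas_fact_Suc n
      by (simp only: algebra_simps)
    also have "\<dots> = ?F * lucas (Suc (Suc x + n))"
      unfolding 1 2 lucas_add using 3 by (simp add: algebra_simps del: lucas.simps)
    also have "\<dots> = lucas_fact (2 * n)"
    proof -
      have "2 * n = Suc (2 * n - 1)" "Suc (Suc x + n) = Suc (2 * n - 1)" using 3 by auto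
      then show ?thesis using lucas_fact_Suc[of "2 * n - 1"] by simp
    qed
    finally show ?thesis by simp
  qed
qed

section \<open>The field of fractions\<close>

text \<open>
  At \<open>s = t = 1\<close> the Lucas polynomials become the Fibonacci numbers. Their positivity allows the
  division by Lucas polynomials in the field of fractions.
\<close>

lemma lucas_at_1_1_pos: "poly (poly (lucas (Suc n)) 1) 1 > 0"
proof -
  have "poly (poly (lucas n) 1) 1 \<ge> 0 \<and> poly (poly (lucas (Suc n)) 1) 1 > 0"
    by (induction n) (auto simp: var_s_def var_t_def)
  then show ?thesis ..
qed

lemma lucas_Suc_nonzero: "lucas (Suc n) \<noteq> 0"
  using lucas_at_1_1_pos[of n] by auto

lemma lucas_fact_nonzero: "lucas_fact n \<noteq> 0"
  by (induction n) (simp_all add: lucas_fact_Suc lucas_Suc_nonzero del: lucas.simps)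

lemma lucas_catalan_eq:
  assumes "P * (lucas_fact n * lucas_fact (n + 1)) = lucas_fact (2 * n)"
  shows "lucas_catalan n = to_fract P"
proof -
  have "to_fract (lucas_fact (2 * n)) =
      to_fract P * (to_fract (lucas_fact n) * (to_fract (lucas_fact n) * to_fract (lucas (n + 1))))"
    unfolding assms[symmetric] by (simp add: lucas_fact_Suc del: lucas.simps)
  then show ?thesis
    using lucas_fact_nonzero[of n] lucas_Suc_nonzero[of n]
    by (simp add: lucas_catalan_def lucasnomial_def del: lucas.simps)
qed

lemma sum_in_Nats: "(\<And>x. x \<in> A \<Longrightarrow> f x \<in> \<nat>) \<Longrightarrow> sum f A \<in> \<nat>"
  by (induction A rule: infinite_finite_induct) auto

lemma coeff_wt_in_Nats: "coeff (coeff (wt C) i) j \<in> \<nat>"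
proof -
  have s: "var_s ^ a = monom 1 a" for a
    
  proof -
    have eq: "var_s = monom 1 1" by (simp add: var_s_def monom_Suc monom_0)
    show ?thesis unfolding eq monom_power by simp
  qed
  have t: "var_t ^ b = monom (monom 1 b) 0" for b
  proof -
    have eq: "var_t = monom (monom 1 1) 0" by (simp add: var_t_def monom_Suc monom_0)
    show ?thesis unfolding eq monom_power by simp
  qed
  show ?thesis
    unfolding wt_def s t mult_monom by simp
qed

theorem corollary4p2:
  fixes n :: nat
  shows "lucas_catalan n = to_fract (\<Sum>C \<in> catalan_partial_tilings n. wt C)
       \<and> lucas_catalan n \<in> nat_polys"
proof -
  have eq: "lucas_catalan n = to_fract (\<Sum>C \<in> catalan_partial_tilings n. wt C)"
    using lucas_catalan_eq[OF weight_catalan_partial_tilings] unfolding weight_def .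
  have "coeff (coeff (\<Sum>C \<in> catalan_partial_tilings n. wt C) i) j \<in> \<nat>" for i j
    unfolding coeff_sum by (intro sum_in_Nats coeff_wt_in_Nats)
  with eq show ?thesis unfolding nat_polys_def by blast
qed

end
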